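(* The modular group $K'=23\infty$, i.e. $PSL(2,\mathbb{Z})$, with presentation $\langle X,Y : X^2=Y^3=e\rangle$, has, up to conjugacy in $K'$, exactly $1$ subgroup of index $2$, exactly $2$ subgroups of index $3$, and exactly $2$ subgroups of index $4$.
   Context: The modular group is the Hecke group $H(\lambda_3)$, denoted $23\infty$ in orbifold notation: the group of linear fractional transformations with integral coefficients (determinant $1$), generated by $X(z)=-1/z$ and $Y(z)=-1/(z+1)$. "Up to conjugacy in $K'$" means that conjugate subgroups of $K'$ are counted once. *)

theory Defs
  imports Complex_Main "HOL-Algebra.Group_Action"
begin

section \<open>Presentations of groups by generators and relators\<close>

text \<open>
  A letter \<open>(i, True)\<close> stands for the generator \<open>i\<close>, and \<open>(i, False)\<close> for its formal inverse.
\<close>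

type_synonym 'i word = "('i \<times> bool) list"

definition letter_val :: "('a, 'b) monoid_scheme \<Rightarrow> ('i \<Rightarrow> 'a) \<Rightarrow> 'i \<times> bool \<Rightarrow> 'a" where
  "letter_val G s l = (if snd l then s (fst l) else inv\<^bsub>G\<^esub> (s (fst l)))"

definition word_val :: "('a, 'b) monoid_scheme \<Rightarrow> ('i \<Rightarrow> 'a) \<Rightarrow> 'i word \<Rightarrow> 'a" where
  "word_val G s w = foldr (\<lambda>l x. letter_val G s l \<otimes>\<^bsub>G\<^esub> x) w \<one>\<^bsub>G\<^esub>"

text \<open>
  The classes of words under the following congruence, with concatenation as product, form the
  quotient of the free group on \<open>'i\<close> by the normal closure of the set \<open>R\<close> of relators.
\<close>

inductive pres_eq :: "'i word set \<Rightarrow> 'i word \<Rightarrow> 'i word \<Rightarrow> bool" for R where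
  pres_refl: "pres_eq R u u"
| pres_sym: "pres_eq R u v \<Longrightarrow> pres_eq R v u"
| pres_trans: "pres_eq R u v \<Longrightarrow> pres_eq R v w \<Longrightarrow> pres_eq R u w"
| pres_cancel: "pres_eq R (u @ [(i, b), (i, \<not> b)] @ v) (u @ v)"
| pres_relator: "r \<in> R \<Longrightarrow> pres_eq R (u @ r @ v) (u @ v)"

text \<open>
  \<open>G\<close> has the presentation \<open>\<langle>'i | R\<rangle>\<close>, the generator \<open>i\<close> corresponding to \<open>s i\<close>: evaluation of words
  induces an isomorphism from the group so presented onto \<open>G\<close>.
\<close>

definition has_presentation :: "('a, 'b) monoid_scheme \<Rightarrow> ('i \<Rightarrow> 'a) \<Rightarrow> 'i word set \<Rightarrow> bool" where
  "has_presentation G s R \<longleftrightarrow>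
     group G \<and> range s \<subseteq> carrier G \<and>
     (\<forall>g\<in>carrier G. \<exists>w. word_val G s w = g) \<and>
     (\<forall>u v. word_val G s u = word_val G s v \<longleftrightarrow> pres_eq R u v)"


section \<open>The modular group\<close>

definition upper_half_plane :: "complex set" where
  "upper_half_plane = {z. 0 < Im z}"

text \<open>
  Linear fractional transformations are taken as extensional maps on the upper half-plane, which
  contains no pole of a real transformation; composition is thus honest composition of maps, and
  a matrix and its negative give the same element.
\<close>

definition lin_frac :: "int \<Rightarrow> int \<Rightarrow> int \<Rightarrow> int \<Rightarrow> complex \<Rightarrow> complex" where
  "lin_frac a b c d =
     (\<lambda>z\<in>upper_half_plane. (of_int a * z + of_int b) / (of_int c * z + of_int d))"

definition modular_group :: "(complex \<Rightarrow> complex) monoid" where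
  "modular_group =
     (BijGroup upper_half_plane)
       \<lparr>carrier := {lin_frac a b c d | a b c d. a * d - b * c = 1}\<rparr>"

datatype modular_generator = X | Y

fun modular_gen :: "modular_generator \<Rightarrow> complex \<Rightarrow> complex" where
  "modular_gen X = (\<lambda>z\<in>upper_half_plane. - 1 / z)"
| "modular_gen Y = (\<lambda>z\<in>upper_half_plane. - 1 / (z + 1))"

definition modular_relators :: "modular_generator word set" where
  "modular_relators = {replicate 2 (X, True), replicate 3 (Y, True)}"


section \<open>Conjugacy classes of subgroups of given index\<close>

text \<open>
  For \<open>n = 0\<close> the following set would consist of the subgroups of infinite index.
\<close>

definition subgroups_of_index :: "('a, 'b) monoid_scheme \<Rightarrow> nat \<Rightarrow> 'a set set" where
  "subgroups_of_index G n = {H. subgroup H G \<and> card (rcosets\<^bsub>G\<^esub> H) = n}"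

definition subgroup_classes_of_index :: "('a, 'b) monoid_scheme \<Rightarrow> nat \<Rightarrow> 'a set set set" where
  "subgroup_classes_of_index G n =
     orbits G (subgroups_of_index G n)
       (\<lambda>g. \<lambda>H\<in>subgroups_of_index G n. g <#\<^bsub>G\<^esub> H #>\<^bsub>G\<^esub> (inv\<^bsub>G\<^esub> g))"

end

theory Submission
  imports Defs
begin

text \<open>
  Evaluation of words is onto because the Euclidean algorithm on the first column of a matrix is a
  word in \<open>z \<mapsto> z + 1\<close> and \<open>z \<mapsto> - 1 / z\<close>, which are \<open>X Y\<close> and \<open>X\<close> (\<open>lin_frac_word_value\<close>). No further
  relators are needed: a word reduces to an alternating one, which is a product of blocks \<open>X Y\<close> and
  \<open>X Y^-1\<close> up to a letter at either end. The blocks are the matrices \<open>(1 1; 0 1)\<close> and \<open>(1 0; 1 1)\<close>.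
  A nonempty product of them has nonnegative entries and is not the identity, while the letters
  at the ends, taken to the other side, give either the identity or a matrix with entries of both
  signs. So only the empty word is trivial (\<open>blocks_nonnegative\<close>, \<open>trivial_normal_form\<close>).

  Subgroups of index \<open>n\<close> up to conjugacy correspond to transitive actions on \<open>n\<close> points up to
  isomorphism: a subgroup is the stabilizer of a point in the action on its cosets, and the
  stabilizers of the other points are its conjugates (\<open>conjugate_point_stabilizer\<close>). By the
  presentation such an action is a pair of permutations \<open>p\<close>, \<open>q\<close> with \<open>p\<^sup>2 = q\<^sup>3 = 1\<close>, and for
  \<open>n \<le> 4\<close> there is little choice. For \<open>n = 2\<close>, \<open>q\<close> is trivial and \<open>p\<close> is the transposition. For
  \<open>n = 3\<close> and \<open>n = 4\<close>, \<open>q\<close> is a three-cycle, for otherwise it would be trivial and orbits would have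
  at most two points. If \<open>n = 3\<close>, \<open>p\<close> is trivial or a transposition. If \<open>n = 4\<close>, \<open>p\<close> exchanges the
  fixed point of \<open>q\<close> with a point of the cycle, and fixes or exchanges the other two.

  In both of these degrees \<open>X Y\<close> has a fixed point in the second action but not in the first, so
  the two stabilizers are not conjugate (\<open>model_classes_distinct\<close>).
\<close>

section \<open>Words and presentations\<close>

lemma (in group) letter_val_closed:
  assumes "range s \<subseteq> carrier G"
  shows "letter_val G s l \<in> carrier G"
  using assms by (auto simp: letter_val_def)

lemma (in group) word_val_closed:
  assumes "range s \<subseteq> carrier G"
  shows "word_val G s w \<in> carrier G"
  using letter_val_closed[OF assms] by (induction w) (auto simp: word_val_def)

lemma word_val_Nil: "word_val G s [] = \<one>\<^bsub>G\<^esub>"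
  by (simp add: word_val_def)

lemma word_val_Cons: "word_val G s (l # w) = letter_val G s l \<otimes>\<^bsub>G\<^esub> word_val G s w"
  by (simp add: word_val_def)

lemma (in group) word_val_append:
  assumes "range s \<subseteq> carrier G"
  shows "word_val G s (u @ v) = word_val G s u \<otimes> word_val G s v"
  by (induction u)
    (simp_all add: word_val_Nil word_val_Cons word_val_closed letter_val_closed assms m_assoc)

lemma (in group) pres_eq_sound:
  assumes s: "range s \<subseteq> carrier G" and rel: "\<And>r. r \<in> R \<Longrightarrow> word_val G s r = \<one>"
    and "pres_eq R u v"
  shows "word_val G s u = word_val G s v"
  using assms(3)
proof induction
  case (pres_cancel u i b v)
  have "word_val G s [(i, b), (i, \<not> b)] = \<one>"
    using s by (cases b) (auto simp: word_val_Nil word_val_Cons letter_val_def range_subsetD)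
  then show ?case
    by (simp only: word_val_append[OF s]) (simp add: word_val_closed[OF s])
next
  case (pres_relator r u v)
  then show ?case
    by (simp add: word_val_append[OF s] rel word_val_closed[OF s])
qed simp_all

lemma pres_eq_context:
  assumes "pres_eq R u v"
  shows "pres_eq R (x @ u @ y) (x @ v @ y)"
  using assms
proof induction
  case (pres_cancel u i b v)
  show ?case using pres_eq.pres_cancel[of R "x @ u" i b "v @ y"] by simp
next
  case (pres_relator r u v)
  then show ?case using pres_eq.pres_relator[of r R "x @ u" "v @ y"] by simp
qed (blast intro: pres_eq.intros)+

definition inverse_word :: "'i word \<Rightarrow> 'i word" where
  "inverse_word w = rev (map (\<lambda>(i, b). (i, \<not> b)) w)"

lemma inverse_word_Cons: "inverse_word ((i, b) # w) = inverse_word w @ [(i, \<not> b)]"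
  by (simp add: inverse_word_def)

lemma inverse_inverse_word: "inverse_word (inverse_word w) = w"
  by (induction w) (auto simp: inverse_word_def)

lemma pres_eq_inverse_word: "pres_eq R (inverse_word w @ w) []"
proof (induction w)
  case Nil
  show ?case by (simp add: inverse_word_def pres_refl)
next
  case (Cons l w)
  obtain i b where l: "l = (i, b)" by fastforce
  have "pres_eq R (inverse_word w @ [(i, \<not> b), (i, \<not> \<not> b)] @ w) (inverse_word w @ w)"
    by (rule pres_cancel)
  with Cons show ?case by (auto simp: l inverse_word_Cons intro: pres_trans)
qed

lemma (in group) word_val_inverse_word:
  assumes "range s \<subseteq> carrier G"
  shows "word_val G s (inverse_word w) = inv (word_val G s w)"
proof -
  have "word_val G s (inverse_word w @ w) = word_val G s []"
    by (rule pres_eq_sound[OF assms, of "{}"]) (auto intro: pres_eq_inverse_word)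
  then show ?thesis
    using assms by (metis inv_equality word_val_Nil word_val_append word_val_closed)
qed

text \<open>
  Two words have the same value, or are congruent, according as \<open>u @ inverse_word v\<close> is trivial in the group, or
  congruent to the empty word. So the relators suffice as soon as every word of trivial value
  reduces to the empty word.
\<close>

lemma (in group) has_presentationI:
  assumes s: "range s \<subseteq> carrier G"
    and rel: "\<And>r. r \<in> R \<Longrightarrow> word_val G s r = \<one>"
    and gen: "\<And>g. g \<in> carrier G \<Longrightarrow> \<exists>w. word_val G s w = g"
    and triv: "\<And>w. word_val G s w = \<one> \<Longrightarrow> pres_eq R w []"
  shows "has_presentation G s R"
  unfolding has_presentation_def
proof (intro conjI ballI allI iffI)
  fix u v assume eq: "word_val G s u = word_val G s v"
  have "word_val G s (u @ inverse_word v) = \<one>"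
    by (simp add: word_val_append s word_val_inverse_word eq word_val_closed)
  then have "pres_eq R ([] @ (u @ inverse_word v) @ v) ([] @ [] @ v)"
    by (intro pres_eq_context triv)
  moreover have "pres_eq R (u @ (inverse_word v @ v) @ []) (u @ [] @ [])"
    by (intro pres_eq_context pres_eq_inverse_word)
  ultimately show "pres_eq R u v" by (auto intro: pres_sym pres_trans)
next
  fix u v assume "pres_eq R u v"
  then show "word_val G s u = word_val G s v" using pres_eq_sound[OF s rel] by blast
qed (use s gen is_group in auto)


section \<open>Actions of a presented group and their stabilizers\<close>

lemma card_range_cong:
  assumes "\<And>x y. f x = f y \<longleftrightarrow> g x = g y"
  shows "card (range f) = card (range g)"
proof -
  have g: "g (inv_into UNIV f (f x)) = g x" for x
    using assms f_inv_into_f[of "f x" f UNIV] by blast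
  have "inj_on (\<lambda>z. g (inv_into UNIV f z)) (range f)"
    by (rule inj_onI) (metis assms f_inv_into_f)
  moreover have "(\<lambda>z. g (inv_into UNIV f z)) ` range f = range g"
    by (simp only: image_image g)
  ultimately show ?thesis by (metis card_image)
qed

text \<open>
  An action of the presented group is given by what the letters do: formally inverse letters must
  undo each other and each relator must act trivially. As \<open>fold\<close> applies the first letter of a word
  first, words act from the right, which is how a group acts on the right cosets of a subgroup.
\<close>

definition letter_action :: "'i word set \<Rightarrow> ('i \<times> bool \<Rightarrow> 'c \<Rightarrow> 'c) \<Rightarrow> bool" where
  "letter_action R \<tau> \<longleftrightarrow>
     (\<forall>i b k. \<tau> (i, \<not> b) (\<tau> (i, b) k) = k) \<and> (\<forall>r\<in>R. \<forall>k. fold \<tau> r k = k)"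

lemma fold_pres_eq:
  assumes "letter_action R \<tau>" "pres_eq R u v"
  shows "fold \<tau> u k = fold \<tau> v k"
  using assms(2,1) by (induction arbitrary: k) (auto simp: letter_action_def)

lemma fold_inverse_word:
  assumes "letter_action R \<tau>"
  shows "fold \<tau> (inverse_word w) (fold \<tau> w k) = k"
    and "fold \<tau> w (fold \<tau> (inverse_word w) k) = k"
proof -
  show "fold \<tau> w (fold \<tau> (inverse_word w) k) = k" for w
    using fold_pres_eq[OF assms pres_eq_inverse_word[of R w]] by simp
  from this[of "inverse_word w"] show "fold \<tau> (inverse_word w) (fold \<tau> w k) = k"
    by (simp add: inverse_inverse_word)
qed

definition point_stabilizer ::
    "('a, 'b) monoid_scheme \<Rightarrow> ('i \<Rightarrow> 'a) \<Rightarrow> ('i \<times> bool \<Rightarrow> 'c \<Rightarrow> 'c) \<Rightarrow> 'c \<Rightarrow> 'a set" where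
  "point_stabilizer G s \<tau> k = word_val G s ` {w. fold \<tau> w k = k}"

definition conjugates :: "('a, 'b) monoid_scheme \<Rightarrow> 'a set \<Rightarrow> 'a set set" where
  "conjugates G H = {g <#\<^bsub>G\<^esub> H #>\<^bsub>G\<^esub> (inv\<^bsub>G\<^esub> g) | g. g \<in> carrier G}"

lemma subgroup_classes_of_index_eq:
  "subgroup_classes_of_index G n = conjugates G ` subgroups_of_index G n"
  by (auto simp: subgroup_classes_of_index_def orbits_def orbit_def conjugates_def)

context group
begin

lemma mem_conjugate_iff:
  assumes "S \<subseteq> carrier G" "g \<in> carrier G" "x \<in> carrier G"
  shows "x \<in> g <# S #> inv g \<longleftrightarrow> inv g \<otimes> x \<otimes> g \<in> S"
proof
  assume "x \<in> g <# S #> inv g"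
  then obtain h where h: "h \<in> S" "x = g \<otimes> h \<otimes> inv g"
    by (auto simp: l_coset_def r_coset_def)
  with assms(1) have "h \<in> carrier G" by auto
  with h assms(2) have "inv g \<otimes> x \<otimes> g = h"
    by (simp add: m_assoc) (simp add: m_assoc[symmetric])
  with h show "inv g \<otimes> x \<otimes> g \<in> S" by simp
next
  assume *: "inv g \<otimes> x \<otimes> g \<in> S"
  have "g \<otimes> (inv g \<otimes> x \<otimes> g) \<otimes> inv g = x"
    using assms(2,3) by (simp add: m_assoc) (simp add: m_assoc[symmetric])
  with * show "x \<in> g <# S #> inv g"
    unfolding l_coset_def r_coset_def by force
qed

lemma conjugate_subset:
  assumes "S \<subseteq> carrier G" "g \<in> carrier G"
  shows "g <# S #> inv g \<subseteq> carrier G"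
  using assms by (simp add: l_coset_subset_G r_coset_subset_G)

lemma conjugate_conjugate:
  assumes "S \<subseteq> carrier G" "g \<in> carrier G" "h \<in> carrier G"
  shows "g <# (h <# S #> inv h) #> inv g = (g \<otimes> h) <# S #> inv (g \<otimes> h)"
proof (rule Set.set_eqI)
  fix x
  show "x \<in> g <# (h <# S #> inv h) #> inv g \<longleftrightarrow> x \<in> (g \<otimes> h) <# S #> inv (g \<otimes> h)"
  proof (cases "x \<in> carrier G")
    case True
    then show ?thesis
      using assms
      by (simp add: mem_conjugate_iff conjugate_subset) (simp add: inv_mult_group m_assoc)
  next
    case False
    then show ?thesis
      using assms by (meson conjugate_subset m_closed subsetD)
  qed
qed

lemma conjugates_conjugate:
  assumes "S \<subseteq> carrier G" "h \<in> carrier G"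
  shows "conjugates G (h <# S #> inv h) = conjugates G S"
proof
  show "conjugates G (h <# S #> inv h) \<subseteq> conjugates G S"
    using assms by (auto simp: conjugates_def conjugate_conjugate)
  show "conjugates G S \<subseteq> conjugates G (h <# S #> inv h)"
  proof
    fix T assume "T \<in> conjugates G S"
    then obtain g where g: "g \<in> carrier G" "T = g <# S #> inv g"
      by (auto simp: conjugates_def)
    have "T = (g \<otimes> inv h) <# (h <# S #> inv h) #> inv (g \<otimes> inv h)"
      using assms g by (simp add: conjugate_conjugate m_assoc)
    then show "T \<in> conjugates G (h <# S #> inv h)"
      using assms g unfolding conjugates_def by blast
  qed
qed

lemma mem_conjugates_self:
  assumes "S \<subseteq> carrier G"
  shows "S \<in> conjugates G S"
proof -
  have "S = \<one> <# S #> inv \<one>" using assms by (simp add: lcos_mult_one)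
  then show ?thesis unfolding conjugates_def by blast
qed

lemma rcoset_eq_iff:
  assumes "subgroup H G" "a \<in> carrier G" "b \<in> carrier G"
  shows "H #> a = H #> b \<longleftrightarrow> a \<otimes> inv b \<in> H"
  by (metis assms coset_join1 coset_join2 coset_mult_inv1 coset_mult_inv2 inv_closed m_closed
      subgroup.subset)

end

locale presented_group = group G for G (structure) +
  fixes s :: "'i \<Rightarrow> 'a" and R :: "'i word set"
  assumes presentation: "has_presentation G s R"
begin

lemma generators_closed: "range s \<subseteq> carrier G"
  using presentation by (simp add: has_presentation_def)

lemmas word_closed = word_val_closed[OF generators_closed]
lemmas word_append = word_val_append[OF generators_closed]
lemmas word_inverse = word_val_inverse_word[OF generators_closed]

lemma obtain_word:
  assumes "g \<in> carrier G"
  obtains w where "g = word_val G s w"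
  using presentation assms by (fastforce simp: has_presentation_def)

lemma fold_eqI:
  assumes "letter_action R \<tau>" "word_val G s u = word_val G s v"
  shows "fold \<tau> u k = fold \<tau> v k"
proof -
  have "pres_eq R u v" using presentation assms(2) unfolding has_presentation_def by blast
  with assms(1) show ?thesis by (rule fold_pres_eq)
qed

lemma word_mem_point_stabilizer:
  assumes "letter_action R \<tau>"
  shows "word_val G s w \<in> point_stabilizer G s \<tau> k \<longleftrightarrow> fold \<tau> w k = k"
proof
  assume "word_val G s w \<in> point_stabilizer G s \<tau> k"
  then obtain v where v: "word_val G s w = word_val G s v" "fold \<tau> v k = k"
    unfolding point_stabilizer_def by blast
  from fold_eqI[OF assms v(1), of k] v(2) show "fold \<tau> w k = k" by (rule trans)
next
  assume "fold \<tau> w k = k"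
  then show "word_val G s w \<in> point_stabilizer G s \<tau> k"
    unfolding point_stabilizer_def by (intro imageI CollectI)
qed

lemma subgroup_point_stabilizer:
  assumes "letter_action R \<tau>"
  shows "subgroup (point_stabilizer G s \<tau> k) G"
proof (rule subgroupI)
  show "point_stabilizer G s \<tau> k \<subseteq> carrier G"
    by (auto simp: point_stabilizer_def word_closed)
  have "word_val G s [] \<in> point_stabilizer G s \<tau> k"
    by (subst word_mem_point_stabilizer[OF assms]) simp
  then show "point_stabilizer G s \<tau> k \<noteq> {}" by blast
next
  fix a assume "a \<in> point_stabilizer G s \<tau> k"
  then obtain w where w: "a = word_val G s w" "fold \<tau> w k = k"
    by (auto simp: point_stabilizer_def)
  then have "fold \<tau> (inverse_word w) k = k"
    using fold_inverse_word(1)[OF assms, of w k] by simp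
  then show "inv a \<in> point_stabilizer G s \<tau> k"
    using assms by (simp add: w(1) word_inverse[symmetric] word_mem_point_stabilizer)
next
  fix a b assume "a \<in> point_stabilizer G s \<tau> k" "b \<in> point_stabilizer G s \<tau> k"
  then obtain u v where "a = word_val G s u" "fold \<tau> u k = k" "b = word_val G s v" "fold \<tau> v k = k"
    by (auto simp: point_stabilizer_def)
  then show "a \<otimes> b \<in> point_stabilizer G s \<tau> k"
    using assms by (simp add: word_append[symmetric] word_mem_point_stabilizer)
qed

text \<open>
  Orbit and stabilizer: the cosets of \<open>u\<close> and \<open>v\<close> agree exactly when the words \<open>u\<close> and \<open>v\<close> move the base
  point to the same place.
\<close>

lemma card_rcosets_point_stabilizer:
  assumes \<tau>: "letter_action R \<tau>"
  shows "card (rcosets (point_stabilizer G s \<tau> k)) = card (range (\<lambda>w. fold \<tau> w k))"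
proof -
  let ?S = "point_stabilizer G s \<tau> k"
  have coset_eq: "?S #> word_val G s u = ?S #> word_val G s v \<longleftrightarrow> fold \<tau> u k = fold \<tau> v k" for u v
  proof -
    have "?S #> word_val G s u = ?S #> word_val G s v \<longleftrightarrow>
        word_val G s (u @ inverse_word v) \<in> ?S"
      by (simp add: rcoset_eq_iff subgroup_point_stabilizer \<tau> word_closed word_append word_inverse)
    also have "\<dots> \<longleftrightarrow> fold \<tau> (inverse_word v) (fold \<tau> u k) = k"
      by (simp add: word_mem_point_stabilizer[OF \<tau>])
    also have "\<dots> \<longleftrightarrow> fold \<tau> u k = fold \<tau> v k"
      by (metis fold_inverse_word[OF \<tau>])
    finally show ?thesis .
  qed
  have cosets: "rcosets ?S = range (\<lambda>w. ?S #> word_val G s w)"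
  proof
    show "rcosets ?S \<subseteq> range (\<lambda>w. ?S #> word_val G s w)"
    proof
      fix C assume "C \<in> rcosets ?S"
      then obtain g where "g \<in> carrier G" "C = ?S #> g" unfolding RCOSETS_def by blast
      then show "C \<in> range (\<lambda>w. ?S #> word_val G s w)" by (metis obtain_word rangeI)
    qed
    show "range (\<lambda>w. ?S #> word_val G s w) \<subseteq> rcosets ?S"
      by (intro image_subsetI rcosetsI subgroup.subset subgroup_point_stabilizer \<tau> word_closed)
  qed
  show ?thesis unfolding cosets by (rule card_range_cong) (rule coset_eq)
qed

lemma fold_coset:
  assumes "C \<subseteq> carrier G"
  shows "fold (\<lambda>l C. C #> letter_val G s l) w C = C #> word_val G s w"
  using assms
proof (induction w arbitrary: C)
  case (Cons l w)
  then show ?case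
    by (simp add: word_val_Cons letter_val_closed[OF generators_closed] r_coset_subset_G
        coset_mult_assoc word_closed)
qed (simp add: word_val_Nil)

text \<open>
  An equivariant injection \<open>\<phi>\<close> of an invariant set of points into the right cosets of \<open>H\<close> matches
  the stabilizer of a point \<open>k\<close> with the stabilizer of the coset \<open>H g\<close>, and the latter is
  \<open>inv g H g\<close>. The base point is thus free to choose; another choice only changes \<open>g\<close>. This is what
  allows an action to be relabelled at will when its stabilizers are classified up to conjugacy.
\<close>

lemma conjugate_point_stabilizer:
  assumes H: "subgroup H G" and \<tau>: "letter_action R \<tau>"
    and inj: "inj_on \<phi> I" and inv: "\<And>l k. k \<in> I \<Longrightarrow> \<tau> l k \<in> I"
    and equivariant: "\<And>l k. k \<in> I \<Longrightarrow> \<phi> (\<tau> l k) = \<phi> k #> letter_val G s l"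
    and k: "k \<in> I" and g: "g \<in> carrier G" "\<phi> k = H #> g"
  shows "H = g <# point_stabilizer G s \<tau> k #> inv g"
proof (rule Set.set_eqI)
  let ?S = "point_stabilizer G s \<tau> k"
  have S: "?S \<subseteq> carrier G" by (intro subgroup.subset subgroup_point_stabilizer \<tau>)
  have fold_\<phi>: "fold \<tau> w j \<in> I \<and> \<phi> (fold \<tau> w j) = fold (\<lambda>l C. C #> letter_val G s l) w (\<phi> j)"
    if "j \<in> I" for w j
    using that by (induction w arbitrary: j) (simp_all add: inv equivariant)
  have Hg: "H #> g \<subseteq> carrier G" using H g by (simp add: r_coset_subset_G subgroup.subset)
  fix x
  show "x \<in> H \<longleftrightarrow> x \<in> g <# ?S #> inv\<^bsub>G\<^esub> g"
  proof (cases "x \<in> carrier G")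
    case True
    obtain w where w: "inv\<^bsub>G\<^esub> g \<otimes> x \<otimes> g = word_val G s w"
      using True g(1) by (meson inv_closed m_closed obtain_word)
    have "x \<in> g <# ?S #> inv\<^bsub>G\<^esub> g \<longleftrightarrow> fold \<tau> w k = k"
      using True g(1) by (simp add: mem_conjugate_iff S w word_mem_point_stabilizer \<tau>)
    also have "\<dots> \<longleftrightarrow> \<phi> (fold \<tau> w k) = \<phi> k"
      using inj k fold_\<phi>[OF k] by (metis inj_on_contraD)
    also have "\<dots> \<longleftrightarrow> H #> g #> word_val G s w = H #> g"
      using fold_\<phi>[OF k] fold_coset[OF Hg] g(2) by simp
    also have "\<dots> \<longleftrightarrow> H #> (x \<otimes> g) = H #> g"
    proof -
      have "g \<otimes> word_val G s w = x \<otimes> g"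
        unfolding w[symmetric] using True g(1) by (simp add: m_assoc[symmetric])
      then show ?thesis
        using H g(1) by (simp add: coset_mult_assoc subgroup.subset word_closed)
    qed
    also have "\<dots> \<longleftrightarrow> x \<in> H"
      using True g(1) H by (simp add: rcoset_eq_iff m_assoc)
    finally show ?thesis by simp
  next
    case False
    have "x \<notin> H" using False subgroup.mem_carrier[OF H] by blast
    moreover have "x \<notin> g <# ?S #> inv\<^bsub>G\<^esub> g"
      using False conjugate_subset[OF S g(1)] by (rule contra_subsetD[rotated])
    ultimately show ?thesis by simp
  qed
qed

text \<open>
  The invariant that separates conjugacy classes. A word \<open>w\<close> fixes a point of the orbit of \<open>k\<close>
  exactly when a conjugate of its value lies in the stabilizer of \<open>k\<close>, and replacing the stabilizer by
  a conjugate subgroup does not affect this.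
\<close>

lemma fixed_point_of_conjugate_stabilizers:
  assumes \<tau>: "letter_action R \<tau>" and \<sigma>: "letter_action R \<sigma>"
    and conj: "conjugates G (point_stabilizer G s \<tau> k) = conjugates G (point_stabilizer G s \<sigma> j)"
    and fixed: "fold \<tau> w (fold \<tau> v k) = fold \<tau> v k"
  shows "\<exists>u. fold \<sigma> w (fold \<sigma> u j) = fold \<sigma> u j"
proof -
  let ?S = "point_stabilizer G s \<tau> k" and ?T = "point_stabilizer G s \<sigma> j"
  have S: "?S \<subseteq> carrier G" and T: "?T \<subseteq> carrier G"
    using \<tau> \<sigma> by (simp_all add: subgroup.subset subgroup_point_stabilizer)
  have "?S \<in> conjugates G ?T" using mem_conjugates_self[OF S] unfolding conj .
  then obtain g where g: "g \<in> carrier G" "?S = g <# ?T #> inv g"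
    unfolding conjugates_def by blast
  obtain a where a: "g = word_val G s a" using g(1) by (rule obtain_word)
  have "word_val G s (v @ w @ inverse_word v) \<in> ?S"
    using fixed fold_inverse_word(1)[OF \<tau>, of v k] by (simp add: word_mem_point_stabilizer[OF \<tau>])
  then have "inv g \<otimes> word_val G s (v @ w @ inverse_word v) \<otimes> g \<in> ?T"
    using mem_conjugate_iff[OF T g(1) word_closed] g(2) by blast
  then have "word_val G s (inverse_word a @ v @ w @ inverse_word v @ a) \<in> ?T"
    by (simp add: a word_append word_inverse word_closed m_assoc)
  then have "fold \<sigma> a (fold \<sigma> (inverse_word v) (fold \<sigma> w (fold \<sigma> (inverse_word a @ v) j))) = j"
    by (simp add: word_mem_point_stabilizer[OF \<sigma>])
  then have "fold \<sigma> w (fold \<sigma> (inverse_word a @ v) j) = fold \<sigma> v (fold \<sigma> (inverse_word a) j)"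
    by (metis fold_inverse_word(2)[OF \<sigma>] fold_append comp_apply inverse_inverse_word)
  then have "fold \<sigma> w (fold \<sigma> (inverse_word a @ v) j) = fold \<sigma> (inverse_word a @ v) j"
    by simp
  then show ?thesis ..
qed

end

section \<open>The presentation of the modular group\<close>

lemma lin_frac_denominator:
  assumes "a * d - b * c = (1::int)" "0 < Im z"
  shows "of_int c * z + of_int d \<noteq> 0"
proof
  assume 0: "of_int c * z + of_int d = 0"
  then have "Im (of_int c * z + of_int d) = 0" by simp
  then have "c = 0" using assms(2) by simp
  with 0 have "d = 0" by simp
  with \<open>c = 0\<close> assms(1) show False by simp
qed

lemma lin_frac_upper_half_plane:
  assumes det: "a * d - b * c = 1" and z: "z \<in> upper_half_plane"
  shows "lin_frac a b c d z \<in> upper_half_plane"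
proof -
  let ?D = "of_int c * z + of_int d"
  have D: "?D \<noteq> 0" using lin_frac_denominator[OF det] z by (simp add: upper_half_plane_def)
  have "Im ((of_int a * z + of_int b) / ?D) = of_int (a * d - b * c) * Im z / (cmod ?D)\<^sup>2"
    by (simp add: Im_divide cmod_def algebra_simps)
  also have "\<dots> > 0" using det D z by (simp add: upper_half_plane_def)
  finally show ?thesis using z by (simp add: lin_frac_def upper_half_plane_def)
qed

lemma lin_frac_compose:
  assumes det: "a * d - b * c = 1" and det': "a' * d' - b' * c' = 1"
  shows "compose upper_half_plane (lin_frac a b c d) (lin_frac a' b' c' d') =
    lin_frac (a * a' + b * c') (a * b' + b * d') (c * a' + d * c') (c * b' + d * d')"
proof
  fix z
  show "compose upper_half_plane (lin_frac a b c d) (lin_frac a' b' c' d') z =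
    lin_frac (a * a' + b * c') (a * b' + b * d') (c * a' + d * c') (c * b' + d * d') z"
  proof (cases "z \<in> upper_half_plane")
    case True
    let ?N = "of_int a' * z + of_int b'" and ?D = "of_int c' * z + of_int d'"
    have D: "?D \<noteq> 0" using lin_frac_denominator[OF det'] True by (simp add: upper_half_plane_def)
    have w: "lin_frac a' b' c' d' z = ?N / ?D" using True by (simp add: lin_frac_def)
    have H: "?N / ?D \<in> upper_half_plane"
      using lin_frac_upper_half_plane[OF det' True] w by simp
    have "(of_int a * (?N / ?D) + of_int b) / (of_int c * (?N / ?D) + of_int d) =
        (of_int a * ?N + of_int b * ?D) / (of_int c * ?N + of_int d * ?D)"
    proof -
      have "(A * (N / D) + B) / (C * (N / D) + E) = (A * N + B * D) / (C * N + E * D)"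
        if "D \<noteq> 0" for A B C D E N :: complex
      proof -
        have "A * (N / D) + B = (A * N + B * D) / D" "C * (N / D) + E = (C * N + E * D) / D"
          using that by (simp_all add: add_divide_distrib)
        then show ?thesis using that by simp
      qed
      from this[OF D] show ?thesis .
    qed
    also have "of_int a * ?N + of_int b * ?D =
        of_int (a * a' + b * c') * z + of_int (a * b' + b * d')"
      by (simp add: algebra_simps)
    also have "of_int c * ?N + of_int d * ?D =
        of_int (c * a' + d * c') * z + of_int (c * b' + d * d')"
      by (simp add: algebra_simps)
    finally show ?thesis
      using True H by (simp add: compose_def w) (simp add: lin_frac_def)
  qed (simp add: compose_def lin_frac_def)
qed

lemma lin_frac_one: "lin_frac 1 0 0 1 = (\<lambda>z\<in>upper_half_plane. z)"
  by (simp add: lin_frac_def)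

text \<open>
  The computations below often end at the negative of the expected matrix; in \<open>PSL(2,\<int>)\<close> the sign
  is immaterial.
\<close>

lemma lin_frac_minus: "lin_frac (- a) (- b) (- c) (- d) = lin_frac a b c d"
proof -
  have "of_int (- m) * z + of_int (- n) = - (of_int m * z + of_int n :: complex)" for m n z
    by simp
  then show ?thesis by (simp only: lin_frac_def minus_divide_divide)
qed

text \<open>
  Two fixed points in the upper half-plane, here \<open>\<i>\<close> and \<open>2 * \<i>\<close>, already force a real matrix to be
  scalar.
\<close>

lemma lin_frac_eq_oneD:
  assumes "a * d - b * c = 1" "lin_frac a b c d = lin_frac 1 0 0 1"
  shows "b = 0" "c = 0" "a = d"
proof -
  have H: "\<i> \<in> upper_half_plane" "2 * \<i> \<in> upper_half_plane"
    by (simp_all add: upper_half_plane_def)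
  have eq: "of_int a * z + of_int b = z * (of_int c * z + of_int d)" if "z \<in> upper_half_plane" for z
  proof -
    have "lin_frac a b c d z = z" using assms(2) that by (simp add: lin_frac_one)
    with that have "(of_int a * z + of_int b) / (of_int c * z + of_int d) = z"
      by (simp add: lin_frac_def)
    moreover have "of_int c * z + of_int d \<noteq> 0"
      using lin_frac_denominator[OF assms(1)] that by (simp add: upper_half_plane_def)
    ultimately show ?thesis by (simp add: divide_eq_eq)
  qed
  from eq[OF H(1)] have 1: "a = d" "b = - c" by (auto simp: complex_eq_iff)
  from eq[OF H(2)] have "real_of_int b = - (4 * real_of_int c)" by (auto simp: complex_eq_iff)
  then have "b = - (4 * c)" by linarith
  with 1 show "b = 0" "c = 0" "a = d" by auto
qed

lemma lin_frac_Bij: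
  assumes det: "a * d - b * c = 1"
  shows "lin_frac a b c d \<in> Bij upper_half_plane"
proof -
  have det': "d * a - (- b) * (- c) = 1" using det by (simp add: algebra_simps)
  have "compose upper_half_plane (lin_frac d (- b) (- c) a) (lin_frac a b c d) = lin_frac 1 0 0 1"
    "compose upper_half_plane (lin_frac a b c d) (lin_frac d (- b) (- c) a) = lin_frac 1 0 0 1"
    using det unfolding lin_frac_compose[OF det' det] lin_frac_compose[OF det det']
    by (simp_all add: algebra_simps)
  then have inverse: "lin_frac d (- b) (- c) a (lin_frac a b c d z) = z"
    "lin_frac a b c d (lin_frac d (- b) (- c) a z) = z" if "z \<in> upper_half_plane" for z
    using that by (simp_all add: lin_frac_one compose_def fun_eq_iff) (metis+)
  have "bij_betw (lin_frac a b c d) upper_half_plane upper_half_plane"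
    by (rule bij_betwI[where g = "lin_frac d (- b) (- c) a"])
      (use lin_frac_upper_half_plane[OF det] lin_frac_upper_half_plane[OF det'] inverse in auto)
  then show ?thesis by (simp add: Bij_def lin_frac_def)
qed

lemma mem_modular_group:
  "f \<in> carrier modular_group \<longleftrightarrow> (\<exists>a b c d. f = lin_frac a b c d \<and> a * d - b * c = 1)"
  by (auto simp: modular_group_def)

lemma lin_frac_closed: "a * d - b * c = 1 \<Longrightarrow> lin_frac a b c d \<in> carrier modular_group"
  unfolding mem_modular_group by blast

lemma modular_group_one: "\<one>\<^bsub>modular_group\<^esub> = lin_frac 1 0 0 1"
  by (simp add: modular_group_def BijGroup_def lin_frac_one)

lemma modular_group_mult:
  assumes "a * d - b * c = 1" "a' * d' - b' * c' = 1"
  shows "lin_frac a b c d \<otimes>\<^bsub>modular_group\<^esub> lin_frac a' b' c' d' =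
    lin_frac (a * a' + b * c') (a * b' + b * d') (c * a' + d * c') (c * b' + d * d')"
  using assms by (simp add: modular_group_def BijGroup_def lin_frac_Bij lin_frac_compose)

lemma det_mult:
  fixes a b c d a' b' c' d' :: int
  assumes "a * d - b * c = 1" "a' * d' - b' * c' = 1"
  shows "(a * a' + b * c') * (c * b' + d * d') - (a * b' + b * d') * (c * a' + d * c') = 1"
proof -
  have "(a * a' + b * c') * (c * b' + d * d') - (a * b' + b * d') * (c * a' + d * c') =
      (a * d - b * c) * (a' * d' - b' * c')" by (simp add: algebra_simps)
  with assms show ?thesis by simp
qed

text \<open>
  Associativity is inherited from the group of bijections of the upper half-plane; the inverse comes
  from the adjugate matrix.
\<close>

lemma group_modular_group: "group modular_group"
proof (rule groupI)
  show "\<one>\<^bsub>modular_group\<^esub> \<in> carrier modular_group"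
    by (simp add: modular_group_one lin_frac_closed)
next
  fix f g assume "f \<in> carrier modular_group" "g \<in> carrier modular_group"
  then show "f \<otimes>\<^bsub>modular_group\<^esub> g \<in> carrier modular_group"
    by (auto simp: mem_modular_group[of f] mem_modular_group[of g] modular_group_mult
        intro!: lin_frac_closed det_mult)
next
  fix f g h
  assume "f \<in> carrier modular_group" "g \<in> carrier modular_group" "h \<in> carrier modular_group"
  then have "f \<in> carrier (BijGroup upper_half_plane)" "g \<in> carrier (BijGroup upper_half_plane)"
    "h \<in> carrier (BijGroup upper_half_plane)"
    by (auto simp: mem_modular_group BijGroup_def lin_frac_Bij)
  then show "f \<otimes>\<^bsub>modular_group\<^esub> g \<otimes>\<^bsub>modular_group\<^esub> h = f \<otimes>\<^bsub>modular_group\<^esub> (g \<otimes>\<^bsub>modular_group\<^esub> h)"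
    using group.is_monoid[OF group_BijGroup[of upper_half_plane]]
    by (simp add: modular_group_def monoid.m_assoc)
next
  fix f assume "f \<in> carrier modular_group"
  then obtain a b c d where f: "f = lin_frac a b c d" and det: "a * d - b * c = 1"
    by (auto simp: mem_modular_group)
  show "\<one>\<^bsub>modular_group\<^esub> \<otimes>\<^bsub>modular_group\<^esub> f = f"
    using det by (simp add: f modular_group_one modular_group_mult)
  have det': "d * a - (- b) * (- c) = 1" using det by (simp add: algebra_simps)
  have "lin_frac d (- b) (- c) a \<otimes>\<^bsub>modular_group\<^esub> f = \<one>\<^bsub>modular_group\<^esub>"
    using det by (simp add: f modular_group_one modular_group_mult[OF det' det] algebra_simps)
  moreover have "lin_frac d (- b) (- c) a \<in> carrier modular_group"
    by (rule lin_frac_closed[OF det'])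
  ultimately show "\<exists>g\<in>carrier modular_group. g \<otimes>\<^bsub>modular_group\<^esub> f = \<one>\<^bsub>modular_group\<^esub>" by blast
qed

interpretation modular: group modular_group by (rule group_modular_group)

lemma modular_gen_eq: "modular_gen X = lin_frac 0 (- 1) 1 0" "modular_gen Y = lin_frac 0 (- 1) 1 1"
  by (auto simp: lin_frac_def intro!: restrict_ext)

lemma modular_gen_closed: "range modular_gen \<subseteq> carrier modular_group"
proof
  fix f assume "f \<in> range modular_gen"
  then obtain i where "f = modular_gen i" by blast
  then show "f \<in> carrier modular_group"
    by (cases i) (simp_all add: modular_gen_eq lin_frac_closed del: modular_gen.simps)
qed

lemmas modular_word_append = modular.word_val_append[OF modular_gen_closed]

lemma modular_letter_val:
  "letter_val modular_group modular_gen (X, b) = lin_frac 0 (- 1) 1 0"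
  "letter_val modular_group modular_gen (Y, True) = lin_frac 0 (- 1) 1 1"
  "letter_val modular_group modular_gen (Y, False) = lin_frac 1 1 (- 1) 0"
proof -
  have gen: "modular_gen i \<in> carrier modular_group" for i using modular_gen_closed by blast
  have "inv\<^bsub>modular_group\<^esub> (modular_gen X) = modular_gen X"
    by (rule modular.inv_equality[OF _ gen gen])
      (simp only: modular_gen_eq modular_group_one, simp add: modular_group_mult,
       use lin_frac_minus[of 1 0 0 1] in simp)
  then show "letter_val modular_group modular_gen (X, b) = lin_frac 0 (- 1) 1 0"
    by (simp add: letter_val_def modular_gen_eq del: modular_gen.simps)
  show "letter_val modular_group modular_gen (Y, True) = lin_frac 0 (- 1) 1 1"
    by (simp add: letter_val_def modular_gen_eq del: modular_gen.simps)
  have "lin_frac 1 1 (- 1) 0 \<in> carrier modular_group"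
    by (rule lin_frac_closed) simp
  then have "inv\<^bsub>modular_group\<^esub> (modular_gen Y) = lin_frac 1 1 (- 1) 0"
    by (intro modular.inv_equality gen)
      (simp_all add: modular_gen_eq modular_group_one modular_group_mult del: modular_gen.simps)
  then show "letter_val modular_group modular_gen (Y, False) = lin_frac 1 1 (- 1) 0"
    by (simp add: letter_val_def del: modular_gen.simps)
qed

lemma modular_relator_val:
  assumes "r \<in> modular_relators"
  shows "word_val modular_group modular_gen r = \<one>\<^bsub>modular_group\<^esub>"
  using assms lin_frac_minus[of 1 0 0 1]
  by (auto simp: modular_relators_def numeral_eq_Suc word_val_Cons word_val_Nil modular_letter_val
      modular_group_one modular_group_mult)

definition word_values :: "(complex \<Rightarrow> complex) set" where
  "word_values = range (word_val modular_group modular_gen)"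

lemma word_values_mult:
  assumes "f \<in> word_values" "g \<in> word_values"
  shows "f \<otimes>\<^bsub>modular_group\<^esub> g \<in> word_values"
proof -
  obtain u v where "f = word_val modular_group modular_gen u" "g = word_val modular_group modular_gen v"
    using assms unfolding word_values_def by blast
  then have "f \<otimes>\<^bsub>modular_group\<^esub> g = word_val modular_group modular_gen (u @ v)"
    by (simp add: modular_word_append)
  then show ?thesis unfolding word_values_def by blast
qed

lemma inversion_word_value: "lin_frac 0 (- 1) 1 0 \<in> word_values"
proof -
  have "word_val modular_group modular_gen [(X, True)] = lin_frac 0 (- 1) 1 0"
    by (simp add: word_val_Cons word_val_Nil modular_letter_val modular_group_one modular_group_mult)
  then show ?thesis unfolding word_values_def by (metis rangeI)
qed

text \<open>
  The product \<open>X Y\<close> is the translation \<open>z \<mapsto> z + 1\<close>.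
\<close>

lemma translation_word_value: "lin_frac 1 k 0 1 \<in> word_values"
proof (induction k rule: int_induct[where k = 0])
  case base
  have "word_val modular_group modular_gen [] = lin_frac 1 0 0 1"
    by (simp add: word_val_Nil modular_group_one)
  then show ?case unfolding word_values_def by (metis rangeI)
next
  case (step1 k)
  have "word_val modular_group modular_gen [(X, True), (Y, True)] = lin_frac 1 1 0 1"
    using lin_frac_minus[of 1 1 0 1]
    by (simp add: word_val_Cons word_val_Nil modular_letter_val modular_group_one modular_group_mult)
  then have "lin_frac 1 1 0 1 \<in> word_values" unfolding word_values_def by (metis rangeI)
  from word_values_mult[OF this step1(2)] show ?case by (simp add: modular_group_mult)
next
  case (step2 k)
  have "word_val modular_group modular_gen [(Y, False), (X, True)] = lin_frac 1 (- 1) 0 1"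
    by (simp add: word_val_Cons word_val_Nil modular_letter_val modular_group_one modular_group_mult)
  then have "lin_frac 1 (- 1) 0 1 \<in> word_values" unfolding word_values_def by (metis rangeI)
  from word_values_mult[OF this step2(2)] show ?case by (simp add: modular_group_mult)
qed

text \<open>
  \<open>X\<close> and \<open>Y\<close> generate, by the Euclidean algorithm on the first column: a translation reduces \<open>a\<close>
  modulo \<open>c\<close>, and the inversion exchanges the two entries.
\<close>

lemma lin_frac_word_value:
  assumes "a * d - b * c = 1"
  shows "lin_frac a b c d \<in> word_values"
  using assms
proof (induction "nat \<bar>c\<bar>" arbitrary: a b c d rule: less_induct)
  case less
  show ?case
  proof (cases "c = 0")
    case True
    then have "a * d = 1" using less.prems by simp
    then consider "a = 1" "d = 1" | "a = -1" "d = -1" by (auto simp: zmult_eq_1_iff)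
    then show ?thesis
    proof cases
      case 1
      then show ?thesis using True translation_word_value by simp
    next
      case 2
      then show ?thesis
        using True translation_word_value[of "- b"] lin_frac_minus[of 1 "- b" 0 1] by simp
    qed
  next
    case False
    define q r where "q = a div c" and "r = a mod c"
    have a: "a = c * q + r" by (simp add: q_def r_def)
    have det: "(- c) * (b - q * d) - (- d) * r = 1"
      using less.prems by (simp add: a algebra_simps)
    have "nat \<bar>r\<bar> < nat \<bar>c\<bar>" using False abs_mod_less[of c a] by (simp add: r_def)
    \<comment> \<open>Euclid's step: translating by \<open>- q\<close> and inverting replaces the bottom-left entry \<open>c\<close> by \<open>a mod c\<close>.\<close>
    from less.hyps[OF this det]
    have "lin_frac (- c) (- d) r (b - q * d) \<in> word_values" .
    then have "lin_frac 1 q 0 1 \<otimes>\<^bsub>modular_group\<^esub> (lin_frac 0 (- 1) 1 0 \<otimes>\<^bsub>modular_group\<^esub>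
        lin_frac (- c) (- d) r (b - q * d)) \<in> word_values"
      by (intro word_values_mult translation_word_value inversion_word_value)
    also have "lin_frac 0 (- 1) 1 0 \<otimes>\<^bsub>modular_group\<^esub> lin_frac (- c) (- d) r (b - q * d)
        = lin_frac (- r) (- (b - q * d)) (- c) (- d)"
      using det by (simp add: modular_group_mult)
    also have "\<dots> = lin_frac r (b - q * d) c d" by (rule lin_frac_minus)
    also have "lin_frac 1 q 0 1 \<otimes>\<^bsub>modular_group\<^esub> lin_frac r (b - q * d) c d = lin_frac a b c d"
    proof -
      have "r * d - (b - q * d) * c = 1" using det by (simp add: algebra_simps)
      then show ?thesis by (simp add: modular_group_mult a algebra_simps)
    qed
    finally show ?thesis .
  qed
qed

definition block :: "bool \<Rightarrow> modular_generator word" where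
  "block b = [(X, True), (Y, b)]"

text \<open>
  Modulo the relators a word can be made to alternate between \<open>X\<close> and \<open>Y^\<plusminus>1\<close>. Cutting it before each
  \<open>X\<close> leaves blocks \<open>X Y^\<plusminus>1\<close>, with possibly a single \<open>Y^\<plusminus>1\<close> in front and a single \<open>X\<close> behind.
\<close>

definition normal_form :: "modular_generator word \<Rightarrow> bool" where
  "normal_form w \<longleftrightarrow> (\<exists>e bs f. w = e @ concat (map block bs) @ f \<and>
     e \<in> {[], [(Y, True)], [(Y, False)]} \<and> f \<in> {[], [(X, True)]})"

lemma normal_formI:
  "e \<in> {[], [(Y, True)], [(Y, False)]} \<Longrightarrow> f \<in> {[], [(X, True)]} \<Longrightarrow>
   normal_form (e @ concat (map block bs) @ f)"
  unfolding normal_form_def by blast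

abbreviation modular_eq :: "modular_generator word \<Rightarrow> modular_generator word \<Rightarrow> bool" where
  "modular_eq \<equiv> pres_eq modular_relators"

lemma modular_eq_reduce:
  "modular_eq ((X, a) # (X, b) # w) w"
  "modular_eq ((Y, b) # (Y, b) # w) ((Y, \<not> b) # w)"
  "modular_eq ((Y, b) # (Y, \<not> b) # w) w"
  "modular_eq ((X, False) # w) ((X, True) # w)"
proof -
  have XX: "modular_eq ((X, True) # (X, True) # w) w" for w
    using pres_relator[of "[(X, True), (X, True)]" modular_relators "[]" w]
    by (simp add: modular_relators_def numeral_eq_Suc)
  have YYY: "modular_eq ((Y, True) # (Y, True) # (Y, True) # w) w" for w
    using pres_relator[of "[(Y, True), (Y, True), (Y, True)]" modular_relators "[]" w]
    by (simp add: modular_relators_def numeral_eq_Suc)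
  have cancel: "modular_eq ((i, b) # (i, \<not> b) # w) w" for i b w
    using pres_cancel[of modular_relators "[]" i b w] by simp
  have cons: "modular_eq (l # u) (l # v)" if "modular_eq u v" for l u v
    using pres_eq_context[OF that, of "[l]" "[]"] by simp
  show XF: "modular_eq ((X, False) # w) ((X, True) # w)" for w
    using cons[OF XX[of w], of "(X, False)"] cancel[of X False "(X, True) # w"]
    by (auto intro: pres_sym pres_trans)
  have X: "modular_eq ((X, c) # w) ((X, True) # w)" for c w
    using XF by (cases c) (simp_all add: pres_refl)
  show "modular_eq ((X, a) # (X, b) # w) w"
    by (rule pres_trans[OF X pres_trans[OF cons[OF X] XX]])
  show "modular_eq ((Y, b) # (Y, \<not> b) # w) w" by (rule cancel)
  have "modular_eq ((Y, True) # (Y, True) # w) ((Y, False) # w)"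
    using cons[OF cons[OF cancel[of Y True w]], of "(Y, True)" "(Y, True)"] YYY[of "(Y, False) # w"]
    by (auto intro: pres_sym pres_trans)
  moreover have "modular_eq ((Y, False) # (Y, False) # w) ((Y, True) # w)"
    using cons[OF cons[OF YYY[of w]], of "(Y, False)" "(Y, False)"]
      cons[OF cancel[of Y False "(Y, True) # (Y, True) # w"], of "(Y, False)"]
      cancel[of Y False "(Y, True) # w"]
    by (auto intro: pres_sym pres_trans)
  ultimately show "modular_eq ((Y, b) # (Y, b) # w) ((Y, \<not> b) # w)" by (cases b) auto
qed

text \<open>
  Normal forms are closed, up to congruence, under prepending a letter, which either becomes the new
  front, merges with it, or cancels against it.
\<close>

lemma ex_normal_form: "\<exists>v. normal_form v \<and> modular_eq w v"
proof (induction w)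
  case Nil
  then show ?case using normal_formI[of "[]" "[]" "[]"] by (auto intro: pres_refl)
next
  case (Cons l w)
  then obtain v where v: "normal_form v" "modular_eq w v" by blast
  have lv: "modular_eq (l # w) (l # v)" using pres_eq_context[OF v(2), of "[l]" "[]"] by simp
  from v(1) obtain e bs f where ebf: "v = e @ concat (map block bs) @ f"
    "e \<in> {[], [(Y, True)], [(Y, False)]}" "f \<in> {[], [(X, True)]}"
    unfolding normal_form_def by blast
  have "\<exists>v'. normal_form v' \<and> modular_eq (l # v) v'"
  proof (cases l)
    case (Pair i b)
    show ?thesis
    proof (cases i)
      case X
      consider (e) b' where "e = [(Y, b')]" | (bs) b' bs' where "e = []" "bs = b' # bs'"
        | (f) "e = []" "bs = []" "f = [(X, True)]" | (empty) "e = []" "bs = []" "f = []"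
        using ebf by (cases bs) auto
      then show ?thesis
      proof cases
        case e
        have "normal_form ([] @ concat (map block (b' # bs)) @ f)"
          using ebf by (intro normal_formI) auto
        then have "normal_form ((X, True) # v)" using ebf(1) e by (simp add: block_def)
        moreover have "modular_eq (l # v) ((X, True) # v)"
          using Pair X modular_eq_reduce(4)[of v] by (cases b) (auto intro: pres_refl)
        ultimately show ?thesis by blast
      next
        case bs
        have "normal_form ([(Y, b')] @ concat (map block bs') @ f)"
          using ebf by (intro normal_formI) (cases b', auto)
        moreover have "modular_eq (l # v) ([(Y, b')] @ concat (map block bs') @ f)"
          using ebf(1) Pair X bs modular_eq_reduce(1) by (simp add: block_def)
        ultimately show ?thesis by blast
      next
        case f
        have "normal_form ([] @ concat (map block []) @ [])" by (intro normal_formI) auto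
        moreover have "modular_eq (l # v) []" using ebf(1) Pair X f modular_eq_reduce(1) by simp
        ultimately show ?thesis by auto
      next
        case empty
        have "normal_form ([] @ concat (map block []) @ [(X, True)])" by (intro normal_formI) auto
        moreover have "modular_eq (l # v) [(X, True)]"
          using ebf(1) Pair X empty modular_eq_reduce(4)[of "[]"] by (cases b) (auto intro: pres_refl)
        ultimately show ?thesis by auto
      qed
    next
      case Y
      let ?P = "concat (map block bs) @ f"
      have nf: "normal_form (e' @ ?P)" if "e' \<in> {[], [(Y, True)], [(Y, False)]}" for e'
        using that ebf by (intro normal_formI)
      consider "e = []" | "e = [(Y, b)]" | "e = [(Y, \<not> b)]" using ebf(2) by (cases b) auto
      then show ?thesis
      proof cases
        case 1
        have "normal_form ([(Y, b)] @ ?P)" by (rule nf) (cases b, auto)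
        then show ?thesis using ebf(1) Pair Y 1 by (auto intro: pres_refl)
      next
        case 2
        have "normal_form ([(Y, \<not> b)] @ ?P)" by (rule nf) (cases b, auto)
        moreover have "modular_eq (l # v) ([(Y, \<not> b)] @ ?P)"
          using ebf(1) Pair Y 2 modular_eq_reduce(2) by simp
        ultimately show ?thesis by blast
      next
        case 3
        have "normal_form ([] @ ?P)" by (rule nf) auto
        moreover have "modular_eq (l # v) ([] @ ?P)"
          using ebf(1) Pair Y 3 modular_eq_reduce(3) by simp
        ultimately show ?thesis by blast
      qed
    qed
  qed
  with lv show ?case by (blast intro: pres_trans)
qed

text \<open>
  \<open>X Y\<close> and \<open>X Y^-1\<close> are \<open>z \<mapsto> z + 1\<close> and \<open>z \<mapsto> z / (z + 1)\<close>, with the unipotent matrices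
  \<open>(1 1; 0 1)\<close> and \<open>(1 0; 1 1)\<close>. Products of these have nonnegative entries, and no cancellation can
  bring a nonempty product back to the identity.
\<close>

lemma blocks_nonnegative:
  "\<exists>a b c d. word_val modular_group modular_gen (concat (map block bs)) = lin_frac a b c d \<and>
     a * d - b * c = 1 \<and> 0 \<le> a \<and> 0 \<le> b \<and> 0 \<le> c \<and> 0 \<le> d \<and> (bs \<noteq> [] \<longrightarrow> 0 < b + c)"
proof (induction bs)
  case Nil
  show ?case
    by (intro exI[of _ 1] exI[of _ 0]) (simp add: word_val_Nil modular_group_one)
next
  case (Cons x bs)
  then obtain a b c d where
    IH: "word_val modular_group modular_gen (concat (map block bs)) = lin_frac a b c d"
    "a * d - b * c = 1" "0 \<le> a" "0 \<le> b" "0 \<le> c" "0 \<le> d" by blast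
  have pos: "0 < a" "0 < d"
  proof -
    have "0 \<le> b * c" using IH by simp
    then have "0 < a * d" using IH(2) by linarith
    then show "0 < a" "0 < d" using IH(3,6) by (auto simp: zero_less_mult_iff)
  qed
  note val = word_val_Cons modular_letter_val modular_group_mult block_def IH(1)
  show ?case
  proof (cases x)
    case True
    have "word_val modular_group modular_gen (concat (map block (x # bs))) =
        lin_frac (- (a + c)) (- (b + d)) (- c) (- d)"
      using IH(2) True by (simp add: val algebra_simps)
    also have "\<dots> = lin_frac (a + c) (b + d) c d" by (rule lin_frac_minus)
    finally show ?thesis using IH pos
      by (intro exI[of _ "a + c"] exI[of _ "b + d"] exI[of _ c] exI[of _ d]) (simp add: algebra_simps)
  next
    case False
    have "word_val modular_group modular_gen (concat (map block (x # bs))) =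
        lin_frac a b (a + c) (b + d)"
      using IH(2) False by (simp add: val algebra_simps)
    then show ?thesis using IH pos
      by (intro exI[of _ "a"] exI[of _ "b"] exI[of _ "a + c"] exI[of _ "b + d"]) (simp add: algebra_simps)
  qed
qed

text \<open>
  If the value is trivial, the product of the blocks is, up to sign, the matrix of one of the six
  words \<open>e^-1 f^-1\<close>. Apart from the identity each of these has entries of both signs, so that it is
  not a product of blocks; and the identity is only the empty product.
\<close>

lemma trivial_normal_form:
  assumes "normal_form w" "word_val modular_group modular_gen w = \<one>\<^bsub>modular_group\<^esub>"
  shows "w = []"
proof -
  obtain e bs f where w: "w = e @ concat (map block bs) @ f"
    and e: "e \<in> {[], [(Y, True)], [(Y, False)]}" and f: "f \<in> {[], [(X, True)]}"
    using assms(1) unfolding normal_form_def by blast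
  obtain a b c d where
    P: "word_val modular_group modular_gen (concat (map block bs)) = lin_frac a b c d"
    and det: "a * d - b * c = 1" and nonneg: "0 \<le> a" "0 \<le> b" "0 \<le> c" "0 \<le> d"
    and bs: "bs \<noteq> [] \<longrightarrow> 0 < b + c"
    using blocks_nonnegative[of bs] by blast
  have val: "word_val modular_group modular_gen e \<otimes>\<^bsub>modular_group\<^esub> (lin_frac a b c d
      \<otimes>\<^bsub>modular_group\<^esub> word_val modular_group modular_gen f) = lin_frac 1 0 0 1"
    using assms(2) by (simp add: w P modular_word_append modular_group_one)
  note simps = word_val_Cons word_val_Nil modular_letter_val modular_group_one modular_group_mult
  have bc: "b = 0 \<and> c = 0 \<longrightarrow> bs = []" using bs by auto
  consider "e = []" "f = []" | "e = []" "f = [(X, True)]"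
    | "e = [(Y, True)]" "f = []" | "e = [(Y, True)]" "f = [(X, True)]"
    | "e = [(Y, False)]" "f = []" | "e = [(Y, False)]" "f = [(X, True)]"
    using e f by blast
  then show "w = []"
  proof cases
    case 1
    have "lin_frac a b c d = lin_frac 1 0 0 1" using val det by (simp add: 1 simps)
    from lin_frac_eq_oneD[OF det this] show ?thesis using bc 1 w by simp
  next
    case 2
    have "lin_frac b (- a) d (- c) = lin_frac 1 0 0 1" using val det by (simp add: 2 simps)
    moreover have "b * (- c) - (- a) * d = 1" using det by (simp add: algebra_simps)
    ultimately have "- a = 0" "d = 0" "b = - c" using lin_frac_eq_oneD by blast+
    moreover from this have "c = 0" using nonneg by linarith
    ultimately show ?thesis using det by simp
  next
    case 3
    have "lin_frac (- c) (- d) (a + c) (b + d) = lin_frac 1 0 0 1" using val det by (simp add: 3 simps)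
    moreover have "(- c) * (b + d) - (- d) * (a + c) = 1" using det by (simp add: algebra_simps)
    ultimately have "- d = 0" "a + c = 0" using lin_frac_eq_oneD by blast+
    moreover from this have "c = 0" using nonneg by linarith
    ultimately show ?thesis using det by simp
  next
    case 4
    have "lin_frac (- d) c (b + d) (- a - c) = lin_frac 1 0 0 1" using val det by (simp add: 4 simps)
    moreover have "(- d) * (- a - c) - c * (b + d) = 1" using det by (simp add: algebra_simps)
    ultimately have "c = 0" "b + d = 0" using lin_frac_eq_oneD by blast+
    moreover from this have "d = 0" using nonneg by linarith
    ultimately show ?thesis using det by simp
  next
    case 5
    have "lin_frac (a + c) (b + d) (- a) (- b) = lin_frac 1 0 0 1" using val det by (simp add: 5 simps)
    moreover have "(a + c) * (- b) - (b + d) * (- a) = 1" using det by (simp add: algebra_simps)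
    ultimately have "- a = 0" "b + d = 0" using lin_frac_eq_oneD by blast+
    moreover from this have "b = 0" using nonneg by linarith
    ultimately show ?thesis using det by simp
  next
    case 6
    have "lin_frac (b + d) (- a - c) (- b) a = lin_frac 1 0 0 1" using val det by (simp add: 6 simps)
    moreover have "(b + d) * a - (- a - c) * (- b) = 1" using det by (simp add: algebra_simps)
    ultimately have "- b = 0" "- a - c = 0" using lin_frac_eq_oneD by blast+
    moreover from this have "a = 0" using nonneg by linarith
    ultimately show ?thesis using det by simp
  qed
qed

lemma modular_group_presentation: "has_presentation modular_group modular_gen modular_relators"
proof (rule modular.has_presentationI[OF modular_gen_closed modular_relator_val])
  fix g assume "g \<in> carrier modular_group"
  then obtain a b c d where "g = lin_frac a b c d" "a * d - b * c = 1"
    unfolding mem_modular_group by blast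
  then have "g \<in> word_values" by (simp add: lin_frac_word_value)
  then show "\<exists>w. word_val modular_group modular_gen w = g" unfolding word_values_def by blast
next
  fix w assume w: "word_val modular_group modular_gen w = \<one>\<^bsub>modular_group\<^esub>"
  obtain v where v: "normal_form v" "modular_eq w v" using ex_normal_form by blast
  have "word_val modular_group modular_gen v = \<one>\<^bsub>modular_group\<^esub>"
    using modular.pres_eq_sound[OF modular_gen_closed modular_relator_val v(2)] w by simp
  with v show "modular_eq w []" using trivial_normal_form by blast
qed

section \<open>Transitive actions of degree two, three and four\<close>

text \<open>
  Transitivity is expressed by the absence of proper nonempty invariant subsets. It suffices to ask
  for invariance under \<open>a\<close> and \<open>b\<close>, since their inverses are \<open>a\<close> and \<open>b \<circ> b\<close>.
\<close>

definition transitive_modular_action :: "'c set \<Rightarrow> ('c \<Rightarrow> 'c) \<Rightarrow> ('c \<Rightarrow> 'c) \<Rightarrow> bool" where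
  "transitive_modular_action C a b \<longleftrightarrow>
     (\<forall>c\<in>C. a c \<in> C \<and> b c \<in> C \<and> a (a c) = c \<and> b (b (b c)) = c) \<and>
     (\<forall>D. D \<subseteq> C \<longrightarrow> D \<noteq> {} \<longrightarrow> (\<forall>c\<in>D. a c \<in> D \<and> b c \<in> D) \<longrightarrow> D = C)"

text \<open>
  When \<open>C\<close> has \<open>n\<close> elements, the equivariant injection \<open>\<phi>\<close> is an isomorphism of actions.
\<close>

definition modelled_by ::
    "'c set \<Rightarrow> ('c \<Rightarrow> 'c) \<Rightarrow> ('c \<Rightarrow> 'c) \<Rightarrow> nat \<Rightarrow> (nat \<Rightarrow> nat) \<Rightarrow> (nat \<Rightarrow> nat) \<Rightarrow> bool" where
  "modelled_by C a b n p q \<longleftrightarrow>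
     (\<exists>\<phi>. inj_on \<phi> {..<n} \<and> \<phi> ` {..<n} \<subseteq> C \<and>
        (\<forall>k<n. \<phi> (p k) = a (\<phi> k) \<and> \<phi> (q k) = b (\<phi> k)))"

lemma ball_less_2:
  "(\<forall>k<(2::nat). P k) \<longleftrightarrow> P 0 \<and> P 1"
  by (auto simp: less_Suc_eq numeral_eq_Suc)

lemma ball_less_3:
  "(\<forall>k<(3::nat). P k) \<longleftrightarrow> P 0 \<and> P 1 \<and> P 2"
  by (auto simp: less_Suc_eq numeral_eq_Suc)

lemma ball_less_4:
  "(\<forall>k<(4::nat). P k) \<longleftrightarrow> P 0 \<and> P 1 \<and> P 2 \<and> P 3"
  by (auto simp: less_Suc_eq numeral_eq_Suc)

lemmas ball_less_numeral = ball_less_2 ball_less_3 ball_less_4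

lemma modelled_by_iff:
  "modelled_by C a b n p q \<longleftrightarrow>
     (\<exists>\<phi>. (\<forall>i<n. \<forall>j<n. \<phi> i = \<phi> j \<longrightarrow> i = j) \<and> (\<forall>k<n. \<phi> k \<in> C) \<and>
        (\<forall>k<n. \<phi> (p k) = a (\<phi> k) \<and> \<phi> (q k) = b (\<phi> k)))"
  unfolding modelled_by_def inj_on_def image_subset_iff Ball_def lessThan_iff by blast

lemma transitive_modular_action_invariant:
  assumes "transitive_modular_action C a b" "D \<subseteq> C" "D \<noteq> {}" "\<And>c. c \<in> D \<Longrightarrow> a c \<in> D" "\<And>c. c \<in> D \<Longrightarrow> b c \<in> D"
  shows "D = C"
  using assms unfolding transitive_modular_action_def by blast

lemma transitive_modular_action_simps:
  assumes "transitive_modular_action C a b" "c \<in> C"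
  shows "a c \<in> C" "b c \<in> C" "a (a c) = c" "b (b (b c)) = c"
  using assms unfolding transitive_modular_action_def by blast+

lemma three_cycle:
  assumes act: "transitive_modular_action C a b" and c: "c \<in> C" and "b c \<noteq> c"
  shows "distinct [c, b c, b (b c)]"
  using assms(3) transitive_modular_action_simps[OF act c] transitive_modular_action_simps[OF act, of "b c"] by force

text \<open>
  If the generator of order three acted trivially, every orbit would consist of at most the two
  points exchanged by the involution.
\<close>

lemma moved_point:
  assumes act: "transitive_modular_action C a b" and "card C \<ge> 3"
  shows "\<exists>c\<in>C. b c \<noteq> c"
proof (rule ccontr)
  assume *: "\<not> (\<exists>c\<in>C. b c \<noteq> c)"
  have "C \<noteq> {}" using assms(2) by auto
  then obtain c where c: "c \<in> C" by blast
  note ac = transitive_modular_action_simps[OF act c]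
  have "{c, a c} = C"
    by (rule transitive_modular_action_invariant[OF act]) (use ac * c in auto)
  moreover have "card {c, a c} \<le> 2" by (simp add: card_insert_if)
  ultimately have "card C \<le> 2" by simp
  with assms(2) show False by simp
qed

abbreviation three_cycle_012 :: "nat \<Rightarrow> nat" where
  "three_cycle_012 \<equiv> id(0 := 1, 1 := 2, 2 := 0)"

text \<open>
  There is no room for a three-cycle, so the action is that of the involution alone, which must
  exchange the two points.
\<close>

lemma model_of_degree_2:
  assumes act: "transitive_modular_action C a b" and card: "card C = 2"
  shows "modelled_by C a b 2 (id(0 := 1, 1 := 0)) id"
proof -
  obtain c d where cd: "C = {c, d}" "c \<noteq> d" using card by (auto simp: card_2_iff)
  have "b x = x" if "x \<in> C" for x
  proof (rule ccontr)
    assume "b x \<noteq> x"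
    then have "card {x, b x, b (b x)} = 3"
      using three_cycle[OF act that] by auto
    moreover have "{x, b x, b (b x)} \<subseteq> C"
      using transitive_modular_action_simps[OF act] that by auto
    ultimately show False using card card_mono[of C "{x, b x, b (b x)}"] cd by simp
  qed
  then have b: "b c = c" "b d = d" using cd by auto
  have "a c \<noteq> c"
  proof
    assume "a c = c"
    then have "{c} = C" by (intro transitive_modular_action_invariant[OF act]) (use b cd in auto)
    with cd show False by auto
  qed
  then have "a c = d" "a d = c"
    using transitive_modular_action_simps[OF act, of c] cd by auto
  then show ?thesis
    unfolding modelled_by_iff ball_less_numeral
    by (intro exI[of _ "(\<lambda>_. c)(1 := d)"]) (use b cd in auto)
qed

text \<open>
  The generator of order three acts as a three-cycle. An involution of three points fixes one of
  them; with that point labelled \<open>0\<close>, it fixes or exchanges the other two.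
\<close>

lemma model_of_degree_3:
  assumes act: "transitive_modular_action C a b" and card: "card C = 3"
  shows "modelled_by C a b 3 id three_cycle_012 \<or>
         modelled_by C a b 3 (id(1 := 2, 2 := 1)) three_cycle_012"
proof -
  have fin: "finite C" using card by (simp add: card_ge_0_finite)
  obtain c where c: "c \<in> C" "b c \<noteq> c" using moved_point[OF act] card by auto
  have orbit: "{x, b x, b (b x)} = C \<and> distinct [x, b x, b (b x)]" if "x \<in> C" "b x \<noteq> x" for x
  proof -
    have d: "distinct [x, b x, b (b x)]" by (rule three_cycle[OF act that])
    have "{x, b x, b (b x)} = C"
      by (rule card_subset_eq[OF fin]) (use d card that transitive_modular_action_simps[OF act] in auto)
    with d show ?thesis by simp
  qed
  have bbb: "b (b (b c)) = c" and aa: "\<And>x. x \<in> C \<Longrightarrow> a (a x) = x" "\<And>x. x \<in> C \<Longrightarrow> a x \<in> C"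
    using transitive_modular_action_simps[OF act] c by auto
  \<comment> \<open>An involution of a set of odd size has a fixed point.\<close>
  obtain e where e: "e \<in> C" "a e = e"
  proof -
    have "a c \<in> {c, b c, b (b c)}" "a (b c) \<in> {c, b c, b (b c)}" "a (b (b c)) \<in> {c, b c, b (b c)}"
      "a (a c) = c" "a (a (b c)) = b c" "a (a (b (b c))) = b (b c)"
      using orbit[OF c] aa by auto
    with orbit[OF c] have "a c = c \<or> a (b c) = b c \<or> a (b (b c)) = b (b c)"
      by auto
    with that orbit[OF c] show thesis by blast
  qed
  have be: "b e \<noteq> e"
    using e(1) orbit[OF c] bbb by auto
  note oe = orbit[OF e(1) be]
  have bbe: "b (b (b e)) = e" using transitive_modular_action_simps[OF act e(1)] by simp
  let ?\<phi> = "(\<lambda>_. e)(1 := b e, 2 := b (b e)) :: nat \<Rightarrow> _"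
  have "a (b e) \<in> {e, b e, b (b e)}" "a (b (b e)) \<in> {e, b e, b (b e)}"
     "a (a (b e)) = b e" "a (a (b (b e))) = b (b e)"
    using oe aa by auto
  then consider "a (b e) = b e" "a (b (b e)) = b (b e)" | "a (b e) = b (b e)" "a (b (b e)) = b e"
    using oe e(2) by auto
  then show ?thesis
  proof cases
    case 1
    then have "modelled_by C a b 3 id three_cycle_012"
      unfolding modelled_by_iff ball_less_numeral
      by (intro exI[of _ ?\<phi>]) (use oe e bbe in auto)
    then show ?thesis ..
  next
    case 2
    then have "modelled_by C a b 3 (id(1 := 2, 2 := 1)) three_cycle_012"
      unfolding modelled_by_iff ball_less_numeral
      by (intro exI[of _ ?\<phi>]) (use oe e bbe in auto)
    then show ?thesis ..
  qed
qed

text \<open>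
  The generator of order three is a three-cycle with one fixed point \<open>d\<close>. By transitivity the
  involution moves \<open>d\<close> to a point of the cycle; with that point labelled \<open>0\<close> and \<open>d\<close> labelled \<open>3\<close>, the
  remaining two points are fixed or exchanged.
\<close>

lemma model_of_degree_4:
  assumes act: "transitive_modular_action C a b" and card: "card C = 4"
  shows "modelled_by C a b 4 (id(0 := 3, 3 := 0)) three_cycle_012 \<or>
         modelled_by C a b 4 (id(0 := 3, 3 := 0, 1 := 2, 2 := 1)) three_cycle_012"
proof -
  have fin: "finite C" using card by (simp add: card_ge_0_finite)
  obtain c where c: "c \<in> C" "b c \<noteq> c" using moved_point[OF act] card by auto
  have dist: "distinct [c, b c, b (b c)]" by (rule three_cycle[OF act c])
  have sub: "{c, b c, b (b c)} \<subseteq> C" using c transitive_modular_action_simps[OF act] by auto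
  have "card (C - {c, b c, b (b c)}) = 1"
    using card_Diff_subset[OF _ sub] dist card by simp
  then obtain d where d: "C - {c, b c, b (b c)} = {d}" by (auto simp: card_1_singleton_iff)
  then have C: "C = {d, c, b c, b (b c)}" and dC: "d \<in> C" "d \<notin> {c, b c, b (b c)}"
    using sub by blast+
  have bbc: "b (b (b c)) = c" and bbd: "b (b (b d)) = d" "b d \<in> C"
    and aa: "\<And>x. x \<in> C \<Longrightarrow> a (a x) = x" "\<And>x. x \<in> C \<Longrightarrow> a x \<in> C"
    using transitive_modular_action_simps[OF act] c dC by auto
  have bd: "b d = d"
  proof -
    have "b d \<in> {d, c, b c, b (b c)}" using bbd(2) C by simp
    with bbd(1) bbc dC(2) show ?thesis by auto
  qed
  have "a d \<noteq> d"
  proof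
    assume "a d = d"
    then have "{d} = C" by (intro transitive_modular_action_invariant[OF act]) (use bd dC in auto)
    with card show False by auto
  qed
  define e where "e = a d"
  have e: "e \<in> {c, b c, b (b c)}" "a e = d" using aa dC C \<open>a d \<noteq> d\<close> by (auto simp: e_def)
  have oe: "C = {d, e, b e, b (b e)}" "distinct [d, e, b e, b (b e)]" "b (b (b e)) = e"
    using e(1) C dC dist bbc by auto
  let ?\<phi> = "(\<lambda>_. e)(1 := b e, 2 := b (b e), 3 := d) :: nat \<Rightarrow> _"
  have "a (b e) \<in> {d, e, b e, b (b e)}" "a (b (b e)) \<in> {d, e, b e, b (b e)}"
     "a (a (b e)) = b e" "a (a (b (b e))) = b (b e)"
    using oe(1) aa by auto
  then consider "a (b e) = b e" "a (b (b e)) = b (b e)" | "a (b e) = b (b e)" "a (b (b e)) = b e"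
    using oe(2) e(2) e_def by auto
  then show ?thesis
  proof cases
    case 1
    then have "modelled_by C a b 4 (id(0 := 3, 3 := 0)) three_cycle_012"
      unfolding modelled_by_iff ball_less_numeral
      by (intro exI[of _ ?\<phi>]) (use oe e e_def bd in auto)
    then show ?thesis ..
  next
    case 2
    then have "modelled_by C a b 4 (id(0 := 3, 3 := 0, 1 := 2, 2 := 1)) three_cycle_012"
      unfolding modelled_by_iff ball_less_numeral
      by (intro exI[of _ ?\<phi>]) (use oe e e_def bd in auto)
    then show ?thesis ..
  qed
qed

section \<open>Counting the classes of subgroups\<close>

fun letter_perm :: "('c \<Rightarrow> 'c) \<Rightarrow> ('c \<Rightarrow> 'c) \<Rightarrow> modular_generator \<times> bool \<Rightarrow> 'c \<Rightarrow> 'c" where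
  "letter_perm p q (X, _) = p"
| "letter_perm p q (Y, True) = q"
| "letter_perm p q (Y, False) = q \<circ> q"

text \<open>
  The permutations act on all natural numbers, so that they are given by plain functions; only the
  points below \<open>n\<close> matter, and these form the orbit of \<open>0\<close>.
\<close>

definition transitive_model :: "nat \<Rightarrow> (nat \<Rightarrow> nat) \<Rightarrow> (nat \<Rightarrow> nat) \<Rightarrow> bool" where
  "transitive_model n p q \<longleftrightarrow>
     0 < n \<and> p \<circ> p = id \<and> q \<circ> q \<circ> q = id \<and> (\<forall>k<n. p k < n \<and> q k < n) \<and>
     (\<forall>k<n. \<exists>w. fold (letter_perm p q) w 0 = k)"

lemma letter_action_letter_perm:
  assumes "p \<circ> p = id" "q \<circ> q \<circ> q = id"
  shows "letter_action modular_relators (letter_perm p q)"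
proof -
  have pq: "p (p k) = k" "q (q (q k)) = k" for k
    using assms by (simp_all add: fun_eq_iff)
  have "letter_perm p q (i, \<not> b) (letter_perm p q (i, b) k) = k" for i b k
    by (cases i; cases b) (simp_all add: pq)
  then show ?thesis
    by (auto simp: letter_action_def modular_relators_def numeral_eq_Suc pq)
qed

lemma letter_perm_less:
  assumes "\<forall>k<n. p k < n \<and> q k < n" "k < n"
  shows "letter_perm p q l k < n"
  using assms by (cases "(p, q, l)" rule: letter_perm.cases) auto

lemma fold_letter_perm_less:
  assumes "\<forall>k<n. p k < n \<and> q k < n" "k < (n::nat)"
  shows "fold (letter_perm p q) w k < n"
  using assms(2) by (induction w arbitrary: k) (simp_all add: letter_perm_less[OF assms(1)])

locale modular_presentation = presented_group G s modular_relators
  for G (structure) and s :: "modular_generator \<Rightarrow> 'a"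
begin

abbreviation model_subgroup :: "(nat \<Rightarrow> nat) \<times> (nat \<Rightarrow> nat) \<Rightarrow> 'a set" where
  "model_subgroup m \<equiv> point_stabilizer G s (letter_perm (fst m) (snd m)) 0"

lemma generator_closed: "s i \<in> carrier G"
  using generators_closed by auto

lemma relator_val:
  assumes "r \<in> modular_relators"
  shows "word_val G s r = \<one>"
proof -
  have "pres_eq modular_relators ([] @ r @ []) ([] @ [])"
    using assms by (rule pres_relator)
  then have "word_val G s r = word_val G s []"
    using presentation unfolding has_presentation_def by simp
  then show ?thesis by (simp add: word_val_Nil)
qed

lemma generator_relations: "s X \<otimes> s X = \<one>" "s Y \<otimes> s Y \<otimes> s Y = \<one>"
  using relator_val[of "replicate 2 (X, True)"] relator_val[of "replicate 3 (Y, True)"]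
  by (simp_all add: modular_relators_def numeral_eq_Suc word_val_Nil word_val_Cons letter_val_def
      generator_closed m_assoc)

lemma inverse_generators: "inv (s X) = s X" "inv (s Y) = s Y \<otimes> s Y"
  using generator_relations generator_closed by (auto intro!: inv_equality simp: m_assoc)

lemma coset_letter_val:
  assumes "C \<subseteq> carrier G"
  shows "C #> letter_val G s l = letter_perm (\<lambda>C. C #> s X) (\<lambda>C. C #> s Y) l C"
proof -
  obtain i b where "l = (i, b)" by fastforce
  then show ?thesis
    by (cases i; cases b)
      (simp_all add: letter_val_def inverse_generators coset_mult_assoc[OF assms] generator_closed)
qed

text \<open>
  A set of cosets invariant under the two generators is invariant under all words, since inverse
  letters act as positive words, and words lead from any coset to any other.
\<close>

lemma transitive_modular_action_rcosets:
  assumes H: "subgroup H G"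
  shows "transitive_modular_action (rcosets H) (\<lambda>C. C #> s X) (\<lambda>C. C #> s Y)"
  unfolding transitive_modular_action_def
proof (intro conjI ballI allI impI)
  fix C assume C: "C \<in> rcosets H"
  then obtain g where g: "g \<in> carrier G" "C = H #> g" unfolding RCOSETS_def by blast
  note simps = coset_mult_assoc subgroup.subset[OF H] generator_closed m_assoc generator_relations
  show "C #> s X \<in> rcosets H" "C #> s Y \<in> rcosets H"
    using g by (simp_all add: simps rcosetsI)
  show "C #> s X #> s X = C" "C #> s Y #> s Y #> s Y = C"
    using g generator_relations(2) by (simp_all add: simps)
next
  fix D assume D: "D \<subseteq> rcosets H" "D \<noteq> {}" and inv: "\<forall>C\<in>D. C #> s X \<in> D \<and> C #> s Y \<in> D"
  have carr: "C \<subseteq> carrier G" if "C \<in> D" for C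
    by (rule subgroup.rcosets_carrier[OF H is_group]) (use that D(1) in blast)
  have closed: "letter_perm (\<lambda>C. C #> s X) (\<lambda>C. C #> s Y) l C \<in> D" if "C \<in> D" for l C
    using that inv
    by (cases "(\<lambda>C. C #> s X, \<lambda>C. C #> s Y, l)" rule: letter_perm.cases) auto
  have words: "C #> word_val G s w \<in> D" if "C \<in> D" for w C
    using that
  proof (induction w arbitrary: C)
    case Nil
    then show ?case by (simp add: word_val_Nil carr)
  next
    case (Cons l w)
    have "C #> letter_val G s l \<in> D"
      using closed[OF Cons.prems, of l] coset_letter_val[OF carr[OF Cons.prems], of l] by simp
    from Cons.IH[OF this] show ?case
      by (simp add: word_val_Cons carr[OF Cons.prems] coset_mult_assoc word_closed
          letter_val_closed[OF generators_closed])
  qed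
  obtain g where g: "g \<in> carrier G" "H #> g \<in> D" using D unfolding RCOSETS_def by blast
  show "D = rcosets H"
  proof
    show "rcosets H \<subseteq> D"
    proof
      fix C assume "C \<in> rcosets H"
      then obtain h where h: "h \<in> carrier G" "C = H #> h" unfolding RCOSETS_def by blast
      obtain w where w: "inv g \<otimes> h = word_val G s w" using g h by (meson inv_closed m_closed obtain_word)
      have "H #> g #> word_val G s w = C"
        using g h by (simp add: w[symmetric] coset_mult_assoc subgroup.subset[OF H] m_assoc[symmetric])
      with words[OF g(2)] show "C \<in> D" by metis
    qed
  qed (rule D(1))
qed

lemma model_subgroup_index:
  assumes "transitive_model n p q"
  shows "model_subgroup (p, q) \<in> subgroups_of_index G n"
proof -
  have "letter_action modular_relators (letter_perm p q)"
    using assms by (simp add: transitive_model_def letter_action_letter_perm)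
  moreover have "range (\<lambda>w. fold (letter_perm p q) w 0) = {..<n}"
    using assms fold_letter_perm_less[of n p q 0] unfolding transitive_model_def
    by (auto simp: image_iff) metis
  ultimately show ?thesis
    by (simp add: subgroups_of_index_def subgroup_point_stabilizer card_rcosets_point_stabilizer)
qed

lemma conjugates_eq_model:
  assumes H: "subgroup H G" and m: "transitive_model n p q"
    and model: "modelled_by (rcosets H) (\<lambda>C. C #> s X) (\<lambda>C. C #> s Y) n p q"
  shows "conjugates G H = conjugates G (model_subgroup (p, q))"
proof -
  have act: "letter_action modular_relators (letter_perm p q)"
    and less: "\<forall>k<n. p k < n \<and> q k < n" and n: "0 < n"
    using m by (simp_all add: transitive_model_def letter_action_letter_perm)
  obtain \<phi> where \<phi>': "inj_on \<phi> {..<n} \<and> \<phi> ` {..<n} \<subseteq> rcosets H \<and>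
      (\<forall>k<n. \<phi> (p k) = \<phi> k #> s X \<and> \<phi> (q k) = \<phi> k #> s Y)"
    using model unfolding modelled_by_def ..
  then have inj: "inj_on \<phi> {..<n}" and \<phi>: "\<phi> ` {..<n} \<subseteq> rcosets H" by blast+
  have eqv: "\<phi> (p k) = \<phi> k #> s X" "\<phi> (q k) = \<phi> k #> s Y" if "k < n" for k
    using \<phi>' that by blast+
  have carr: "\<phi> k \<subseteq> carrier G" if "k < n" for k
    by (rule subgroup.rcosets_carrier[OF H is_group]) (use that \<phi> in blast)
  have eqv': "\<phi> (letter_perm p q l k) = \<phi> k #> letter_val G s l" if "k < n" for k l
    unfolding coset_letter_val[OF carr[OF that]]
    using that less by (cases "(p, q, l)" rule: letter_perm.cases) (simp_all add: eqv)
  obtain g where g: "g \<in> carrier G" "\<phi> 0 = H #> g"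
    using \<phi> n unfolding RCOSETS_def by blast
  have "H = g <# model_subgroup (p, q) #> inv g"
    using conjugate_point_stabilizer[OF H act inj _ _ _ g] n letter_perm_less[OF less] eqv' by simp
  moreover have "model_subgroup (p, q) \<subseteq> carrier G"
    using subgroup_point_stabilizer[OF act] by (simp add: subgroup.subset)
  ultimately show ?thesis using conjugates_conjugate[OF _ g(1)] by metis
qed

text \<open>
  Classifying subgroups of index \<open>n\<close> up to conjugacy amounts to classifying transitive actions on \<open>n\<close>
  points up to isomorphism.
\<close>

lemma classes_eq_models:
  assumes models: "\<And>p q. (p, q) \<in> M \<Longrightarrow> transitive_model n p q"
    and complete: "\<And>C a b. transitive_modular_action (C :: 'a set set) a b \<Longrightarrow> card C = n \<Longrightarrow>
      \<exists>(p, q)\<in>M. modelled_by C a b n p q"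
  shows "subgroup_classes_of_index G n = (\<lambda>m. conjugates G (model_subgroup m)) ` M"
  unfolding subgroup_classes_of_index_eq
proof
  show "conjugates G ` subgroups_of_index G n \<subseteq> (\<lambda>m. conjugates G (model_subgroup m)) ` M"
  proof (rule image_subsetI)
    fix H assume "H \<in> subgroups_of_index G n"
    then have H: "subgroup H G" "card (rcosets H) = n" by (simp_all add: subgroups_of_index_def)
    then obtain p q where m: "(p, q) \<in> M"
        "modelled_by (rcosets H) (\<lambda>C. C #> s X) (\<lambda>C. C #> s Y) n p q"
      using complete[OF transitive_modular_action_rcosets[OF H(1)] H(2)] by blast
    show "conjugates G H \<in> (\<lambda>m. conjugates G (model_subgroup m)) ` M"
      by (rule image_eqI[OF _ m(1)]) (rule conjugates_eq_model[OF H(1) models[OF m(1)] m(2)])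
  qed
  show "(\<lambda>m. conjugates G (model_subgroup m)) ` M \<subseteq> conjugates G ` subgroups_of_index G n"
    using models model_subgroup_index by fastforce
qed

text \<open>
  The models are told apart by the parabolic element \<open>X Y\<close>, that is \<open>z \<mapsto> z + 1\<close> in the modular group.
  Its cycles correspond to the cusps of the subgroup, and the invariant is whether there is a cusp of
  width one.
\<close>

lemma model_classes_distinct:
  assumes m: "transitive_model n p q" and m': "transitive_model n p' q'"
    and fixed: "\<exists>k<n. q (p k) = k" and free: "\<forall>k<n. q' (p' k) \<noteq> k"
  shows "conjugates G (model_subgroup (p, q)) \<noteq> conjugates G (model_subgroup (p', q'))"
proof
  assume eq: "conjugates G (model_subgroup (p, q)) = conjugates G (model_subgroup (p', q'))"
  have act: "letter_action modular_relators (letter_perm p q)"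
    "letter_action modular_relators (letter_perm p' q')"
    using m m' by (simp_all add: transitive_model_def letter_action_letter_perm)
  let ?t = "[(X, True), (Y, True)]"
  obtain v where "fold (letter_perm p q) ?t (fold (letter_perm p q) v 0) = fold (letter_perm p q) v 0"
    using fixed m unfolding transitive_model_def by fastforce
  from fixed_point_of_conjugate_stabilizers[OF act eq[simplified] this]
  obtain u where "fold (letter_perm p' q') ?t (fold (letter_perm p' q') u 0)
      = fold (letter_perm p' q') u 0" by blast
  moreover have "fold (letter_perm p' q') u 0 < n"
    using m' unfolding transitive_model_def by (intro fold_letter_perm_less) auto
  ultimately show False using free by simp
qed

lemma card_classes_of_index_2: "card (subgroup_classes_of_index G 2) = 1"
proof -
  have "\<exists>w. fold (letter_perm (id(0 := 1, 1 := 0)) id) w 0 = (0::nat)"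
    by (rule exI[of _ "[]"]) simp
  moreover have "\<exists>w. fold (letter_perm (id(0 := 1, 1 := 0)) id) w 0 = (1::nat)"
    by (rule exI[of _ "[(X, True)]"]) simp
  ultimately have "transitive_model 2 (id(0 := 1, 1 := 0)) id"
    unfolding transitive_model_def ball_less_numeral by (simp add: fun_eq_iff)
  then have "subgroup_classes_of_index G 2 =
      (\<lambda>m. conjugates G (model_subgroup m)) ` {(id(0 := 1, 1 := 0), id)}"
    by (intro classes_eq_models) (auto dest: model_of_degree_2)
  then show ?thesis by simp
qed

lemma card_classes_of_two_models:
  assumes m: "transitive_model n p q" and m': "transitive_model n p' q'"
    and fixed: "\<exists>k<n. q (p k) = k" and free: "\<forall>k<n. q' (p' k) \<noteq> k"
    and complete: "\<And>C a b. transitive_modular_action (C :: 'a set set) a b \<Longrightarrow> card C = n \<Longrightarrow>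
      modelled_by C a b n p' q' \<or> modelled_by C a b n p q"
  shows "card (subgroup_classes_of_index G n) = 2"
proof -
  have "subgroup_classes_of_index G n =
      (\<lambda>m. conjugates G (model_subgroup m)) ` {(p, q), (p', q')}"
    using m m' by (intro classes_eq_models) (auto dest: complete)
  then show ?thesis using model_classes_distinct[OF m m' fixed free] by simp
qed

lemma transitive_model_three_cycle:
  assumes "3 \<le> n" "p \<circ> p = id" "\<forall>k<n. p k < n" "\<forall>k<n. 3 \<le> k \<longrightarrow> p 0 = k"
  shows "transitive_model n p three_cycle_012"
proof -
  have "\<exists>w. fold (letter_perm p three_cycle_012) w 0 = k" if "k < n" for k
  proof -
    consider "k = 0" | "k = 1" | "k = 2" | "3 \<le> k" by linarith
    then show ?thesis
    proof cases
      case 1 then show ?thesis by (intro exI[of _ "[]"]) simp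
    next
      case 2 then show ?thesis by (intro exI[of _ "[(Y, True)]"]) simp
    next
      case 3 then show ?thesis by (intro exI[of _ "[(Y, True), (Y, True)]"]) simp
    next
      case 4 then show ?thesis using that assms by (intro exI[of _ "[(X, True)]"]) simp
    qed
  qed
  with assms show ?thesis unfolding transitive_model_def by (auto simp: fun_eq_iff)
qed

lemma card_classes_of_index_3: "card (subgroup_classes_of_index G 3) = 2"
proof (rule card_classes_of_two_models)
  show "transitive_model 3 (id(1 := 2, 2 := 1)) three_cycle_012"
    by (rule transitive_model_three_cycle) (auto simp: fun_eq_iff)
  show "transitive_model 3 id three_cycle_012"
    by (rule transitive_model_three_cycle) auto
  show "\<exists>k<3. three_cycle_012 ((id(1 := 2, 2 := 1)) k) = k"
    by (intro exI[of _ 2]) simp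
  show "\<forall>k<3. three_cycle_012 (id k) \<noteq> k"
    unfolding ball_less_numeral by simp
qed (rule model_of_degree_3)

lemma card_classes_of_index_4: "card (subgroup_classes_of_index G 4) = 2"
proof (rule card_classes_of_two_models)
  show "transitive_model 4 (id(0 := 3, 3 := 0, 1 := 2, 2 := 1)) three_cycle_012"
    by (rule transitive_model_three_cycle) (auto simp: fun_eq_iff)
  show "transitive_model 4 (id(0 := 3, 3 := 0)) three_cycle_012"
    by (rule transitive_model_three_cycle) (auto simp: fun_eq_iff)
  show "\<exists>k<4. three_cycle_012 ((id(0 := 3, 3 := 0, 1 := 2, 2 := 1)) k) = k"
    by (intro exI[of _ 2]) simp
  show "\<forall>k<4. three_cycle_012 ((id(0 := 3, 3 := 0)) k) \<noteq> k"
    unfolding ball_less_numeral by simp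
qed (rule model_of_degree_4)

end

theorem corollary4:
  shows "has_presentation modular_group modular_gen modular_relators
       \<and> card (subgroup_classes_of_index modular_group 2) = 1
       \<and> card (subgroup_classes_of_index modular_group 3) = 2
       \<and> card (subgroup_classes_of_index modular_group 4) = 2"
proof -
  interpret modular_presentation modular_group modular_gen
    by unfold_locales (rule modular_group_presentation)
  show ?thesis
    using modular_group_presentation card_classes_of_index_2 card_classes_of_index_3
      card_classes_of_index_4 by blast
qed

end
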